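(* Let $f:\mathbb{S}^n\to\mathbb{R}$ be convex and continuously differentiable, let $\mathcal{A}:\mathbb{S}^n\to\mathbb{R}^m$ and $\mathcal{B}:\mathbb{S}^n\to\mathbb{R}^p$ be linear maps, let $b\in\mathbb{R}^m$, and let $\mathcal{P}\subset\mathbb{R}^p$ be a closed convex set. Let $g$, $\mathcal{H}$, $c$ be as defined in the context. Let $(z^k,\gamma^k)_{k\ge 1}$, with $z^k=(X^k,y^k)$ and $\gamma^k=(\lambda^k,\mu^k)$, be a sequence generated by the preconditioned augmented Lagrangian method described in the context, with penalty parameters $\beta_1,\beta_2>0$ and positive definite weight matrices $W^k\in\mathbb{S}^m$. Suppose that: 1. (Feasibility) there exists $z^*\in\mathbb{S}^n_+\times\mathcal{P}$ with $\mathcal{H}(z^* )=c$; 2. (Inexact subproblem solution) there are $\epsilon_k>0$ with $\sum_{k=1}^\infty\epsilon_k<\infty$ such that for every $k\ge 1$, $$\mathrm{dist}\Big(\partial\delta_{\mathbb{S}^n_+}(X^{k+1})+\nabla f(X^{k+1})-\mathcal{A}^*(\lambda^k)+\beta_1\mathcal{A}^*\big(W^k(\mathcal{A}(X^{k+1})-b)\big)+\beta_2\mathcal{B}^*\big(\mathcal{B}(X^{k+1})-\mu^k/\beta_2-\Pi_{\mathcal{P}}(\mathcal{B}(X^{k+1})-\mu^k/\beta_2)\big),\,0\Big)<\epsilon_k;$$ 3. the sequence $\{z^k\}_{k\ge1}$ is bounded; 4. there exists $\sigma>0$ such that $W^k\succeq\sigma I_m$ for all $k$. Then the KKT residual satisfies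 $$\max\left\{\mathrm{dist}\big(\partial g(z^k)-\mathcal{H}^*(\gamma^k),0\big),\ \|\mathcal{H}(z^k)-c\|_2\right\}\to 0\quad\text{as }k\to\infty.$$
   Context: Notation. $\mathbb{S}^n$ is the space of real symmetric $n\times n$ matrices with the trace inner product, and $\mathbb{S}^n_+$ is the cone of positive semidefinite matrices in it. Product spaces such as $\mathbb{S}^n\times\mathbb{R}^p$ and $\mathbb{R}^m\times\mathbb{R}^p$ carry the product inner product and norm. $\delta_C$ is the indicator function of a set $C$ ($0$ on $C$, $+\infty$ off $C$), $\partial$ is the convex subdifferential, $\Pi_{\mathcal{P}}$ is the Euclidean projection onto $\mathcal{P}$, $\mathrm{dist}(S,0)=\inf_{s\in S}\|s\|$ (equal to $+\infty$ if $S=\emptyset$), a superscript $*$ on a linear map denotes its adjoint, and $W\succeq\sigma I_m$ means that $W-\sigma I_m$ is positive semidefinite. For $M$ positive definite, $\|u\|_M^2=u^\top M u$. Problem. The method addresses $$\min\{f(X):\ \mathcal{A}(X)=b,\ \mathcal{B}(X)\in\mathcal{P},\ X\in\mathbb{S}^n_+\},$$ rewritten with $z=(X,y)\in\mathbb{S}^n\times\mathbb{R}^p$ as $\min\{g(z):\mathcal{H}(z)=c\}$, where $$g(z)=f(X)+\delta_{\mathbb{S}^n_+}(X)+\delta_{\mathcal{P}}(y),\qquad \mathcal{H}(z)=(\mathcal{A}(X),\ \mathcal{B}(X)-y)\in\mathbb{R}^m\times\mathbb{R}^p,\qquad c=(b,0_p).$$ Preconditioned augmented Lagrangian method. Fix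 a positive integer $r$. Choose $R^1\in\mathbb{R}^{n\times r}$, $\lambda^1\in\mathbb{R}^m$, $\mu^1\in\mathbb{R}^p$ and $\beta_1,\beta_2>0$. For $k=1,2,\dots$: (i) choose a positive definite $W^k\in\mathbb{S}^m$; (ii) obtain $R^{k+1}\in\mathbb{R}^{n\times r}$ by (approximately) solving $$\min_{R\in\mathbb{R}^{n\times r}}\ f(RR^\top)-\langle\lambda^k,\mathcal{A}(RR^\top)-b\rangle+\frac{\beta_1}{2}\|\mathcal{A}(RR^\top)-b\|_{W^k}^2+\frac{\beta_2}{2}\mathrm{dist}\big(\mathcal{B}(RR^\top)-\mu^k/\beta_2,\mathcal{P}\big)^2-\frac{\|\mu^k\|^2}{2\beta_2},$$ where the accuracy required of $R^{k+1}$ is exactly hypothesis 2 of the claim, with $X^{k+1}=R^{k+1}(R^{k+1})^\top$; (iii) set $$\lambda^{k+1}=\lambda^k-\beta_1W^k\big(\mathcal{A}(X^{k+1})-b\big),$$ $$\mu^{k+1}=\beta_2\Big(\Pi_{\mathcal{P}}\big(\mathcal{B}(X^{k+1})-\mu^k/\beta_2\big)-\big(\mathcal{B}(X^{k+1})-\mu^k/\beta_2\big)\Big).$$ The associated primal iterates are $X^k=R^k(R^k)^\top$ for all $k\ge1$ and $y^{k+1}=\Pi_{\mathcal{P}}(\mathcal{B}(X^{k+1})-\mu^k/\beta_2)$ for $k\ge1$ ($y^1\in\mathbb{R}^p$ is arbitrary and plays no role). One sets $z^k=(X^k,y^k)$ and $\gamma^k=(\lambda^k,\mu^k)$. *)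

theory Defs
  imports "HOL-Analysis.Analysis"
begin

typedef 'n symmat = "{A :: real ^ 'n::finite ^ 'n. transpose A = A}"
  morphisms mat_of Abs_symmat
  by (rule exI[of _ 0]) (simp add: transpose_def zero_vec_def vec_eq_iff)

setup_lifting type_definition_symmat

lemma transpose_mat_of [simp]: "transpose (mat_of A) = mat_of A"
  using mat_of[of A] by simp

lemma mat_of_sym: "mat_of A $ i $ j = mat_of A $ j $ i"
proof -
  have "transpose (mat_of A) $ j $ i = mat_of A $ j $ i"
    by simp
  then show ?thesis
    unfolding transpose_def vec_lambda_beta .
qed

instantiation symmat :: (finite) real_vector
begin

lift_definition zero_symmat :: "'a symmat" is 0
  by (simp add: transpose_def vec_eq_iff)

lift_definition plus_symmat :: "'a symmat \<Rightarrow> 'a symmat \<Rightarrow> 'a symmat" is "(+)"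
  by (simp add: transpose_def vec_eq_iff)

lift_definition minus_symmat :: "'a symmat \<Rightarrow> 'a symmat \<Rightarrow> 'a symmat" is "(-)"
  by (simp add: transpose_def vec_eq_iff)

lift_definition uminus_symmat :: "'a symmat \<Rightarrow> 'a symmat" is uminus
  by (simp add: transpose_def vec_eq_iff)

lift_definition scaleR_symmat :: "real \<Rightarrow> 'a symmat \<Rightarrow> 'a symmat" is scaleR
  by (simp add: transpose_def vec_eq_iff)

instance
  by standard (transfer; simp add: algebra_simps)+

end

instantiation symmat :: (finite) real_normed_vector
begin

definition norm_symmat :: "'a symmat \<Rightarrow> real" where
  "norm_symmat A = norm (mat_of A)"

definition sgn_symmat :: "'a symmat \<Rightarrow> 'a symmat" where
  "sgn_symmat A = A /\<^sub>R norm A"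

definition dist_symmat :: "'a symmat \<Rightarrow> 'a symmat \<Rightarrow> real" where
  "dist_symmat A B = norm (A - B)"

definition uniformity_symmat :: "('a symmat \<times> 'a symmat) filter" where
  "uniformity_symmat = (INF e\<in>{0<..}. principal {(A, B). dist A B < e})"

definition open_symmat :: "'a symmat set \<Rightarrow> bool" where
  "open_symmat U \<longleftrightarrow> (\<forall>A\<in>U. \<forall>\<^sub>F (A', B) in uniformity. A' = A \<longrightarrow> B \<in> U)"

instance
proof
  fix A B :: "'a symmat" and r :: real
  show "norm A = 0 \<longleftrightarrow> A = 0"
    by (simp add: norm_symmat_def mat_of_inject[symmetric] zero_symmat.rep_eq)
  show "norm (A + B) \<le> norm A + norm B"
    by (simp add: norm_symmat_def plus_symmat.rep_eq norm_triangle_ineq)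
  show "norm (r *\<^sub>R A) = \<bar>r\<bar> * norm A"
    by (simp add: norm_symmat_def scaleR_symmat.rep_eq)
qed (rule sgn_symmat_def dist_symmat_def uniformity_symmat_def open_symmat_def)+

end

instantiation symmat :: (finite) real_inner
begin

definition inner_symmat :: "'a symmat \<Rightarrow> 'a symmat \<Rightarrow> real" where
  "inner_symmat A B = trace (mat_of A ** mat_of B)"

lemma inner_mat_of: "inner A B = inner (mat_of A) (mat_of B)"
  unfolding inner_symmat_def trace_def matrix_matrix_mult_def inner_vec_def
  by (intro sum.cong refl) (simp add: mat_of_sym[of B])

instance
proof
  fix A B C :: "'a symmat" and r :: real
  show "inner A B = inner B A"
    by (simp add: inner_mat_of inner_commute)
  show "inner (A + B) C = inner A C + inner B C"
    by (simp add: inner_mat_of plus_symmat.rep_eq inner_add_left)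
  show "inner (r *\<^sub>R A) B = r * inner A B"
    by (simp add: inner_mat_of scaleR_symmat.rep_eq)
  show "0 \<le> inner A A"
    by (simp add: inner_mat_of)
  show "inner A A = 0 \<longleftrightarrow> A = 0"
    by (simp add: inner_mat_of mat_of_inject[symmetric] zero_symmat.rep_eq)
  show "norm A = sqrt (inner A A)"
    by (simp add: inner_mat_of norm_symmat_def norm_eq_sqrt_inner)
qed

end

text \<open>
  With \<open>sym_unit i j\<close> the symmetric matrix unit \<open>E_ij + E_ji\<close> (twice \<open>E_ii\<close> if \<open>i = j\<close>), each
  unordered pair of indices contributes one normalised element to the orthonormal basis below.
\<close>

lift_definition sym_unit :: "'n::finite \<Rightarrow> 'n \<Rightarrow> 'n symmat" is
  "\<lambda>i j. axis i (axis j 1) + axis j (axis i 1)"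
  by (auto simp: transpose_def vec_eq_iff axis_def)

lemma inner_sym_unit: "inner A (sym_unit i j) = 2 * mat_of A $ i $ j"
  unfolding inner_mat_of sym_unit.rep_eq inner_add_right inner_axis
  using mat_of_sym[of A j i] by simp

lemma sym_unit_commute: "sym_unit i j = sym_unit j i"
  by transfer (rule add.commute)

lemma sym_unit_nonzero: "sym_unit i j \<noteq> 0"
proof
  assume "sym_unit i j = 0"
  then have "mat_of (sym_unit i j) $ i $ j = 0"
    by (simp add: zero_symmat.rep_eq)
  then show False
    by (auto simp: sym_unit.rep_eq axis_def split: if_splits)
qed

instantiation symmat :: (finite) euclidean_space
begin

definition Basis_symmat :: "'a symmat set" where
  "Basis_symmat = (\<lambda>(i, j). sgn (sym_unit i j)) ` UNIV"

instance
proof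
  show "(Basis :: 'a symmat set) \<noteq> {}" "finite (Basis :: 'a symmat set)"
    by (simp_all add: Basis_symmat_def)
next
  fix u v :: "'a symmat"
  assume "u \<in> Basis" "v \<in> Basis"
  then obtain i j k l where uv: "u = sgn (sym_unit i j)" "v = sgn (sym_unit k l)"
    by (auto simp: Basis_symmat_def)
  show "inner u v = (if u = v then 1 else 0)"
  proof (cases "u = v")
    case True
    have "norm v = 1"
      by (simp add: uv norm_sgn sym_unit_nonzero)
    then show ?thesis
      using True by (simp add: norm_eq_1)
  next
    case False
    then have "\<not> (i = k \<and> j = l)" "\<not> (i = l \<and> j = k)"
      using sym_unit_commute uv by metis+
    then have "inner (sym_unit i j) (sym_unit k l) = 0"
      by (auto simp: inner_sym_unit sym_unit.rep_eq axis_def)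
    then show ?thesis
      using False by (simp add: uv sgn_div_norm)
  qed
next
  fix A :: "'a symmat"
  show "(\<forall>u\<in>Basis. inner A u = 0) \<longleftrightarrow> A = 0"
  proof
    assume "\<forall>u\<in>Basis. inner A u = 0"
    then have "inner A (sgn (sym_unit i j)) = 0" for i j
      by (auto simp: Basis_symmat_def)
    then have "mat_of A $ i $ j = 0" for i j
      by (simp add: sgn_div_norm sym_unit_nonzero inner_sym_unit)
    then have "mat_of A = mat_of 0"
      by (simp add: vec_eq_iff zero_symmat.rep_eq)
    then show "A = 0"
      by (simp add: mat_of_inject)
  qed simp
qed

end

lift_definition id_symmat :: "'n::finite symmat" is "mat 1"
  by (rule transpose_mat)

lift_definition gram :: "real ^ 'r ^ 'n \<Rightarrow> 'n::finite symmat" is "\<lambda>R. R ** transpose R"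
  by (simp add: matrix_transpose_mul)

definition psd :: "'n::finite symmat \<Rightarrow> bool" where
  "psd A \<longleftrightarrow> (\<forall>u. 0 \<le> inner u (mat_of A *v u))"

definition posdef :: "'n::finite symmat \<Rightarrow> bool" where
  "posdef A \<longleftrightarrow> (\<forall>u. u \<noteq> 0 \<longrightarrow> 0 < inner u (mat_of A *v u))"

definition psd_cone :: "'n::finite symmat set" where
  "psd_cone = {A. psd A}"

definition convex_indicator :: "'a set \<Rightarrow> 'a \<Rightarrow> ereal" where
  "convex_indicator C x = (if x \<in> C then 0 else \<infinity>)"

text \<open>For a proper function the subdifferential below is empty outside the effective domain.\<close>

definition subdifferential :: "('a::real_inner \<Rightarrow> ereal) \<Rightarrow> 'a \<Rightarrow> 'a set" where
  "subdifferential h x = {v. \<forall>y. h x + ereal (inner v (y - x)) \<le> h y}"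

text \<open>The library constant \<^const>\<open>infdist\<close> is 0 on the empty set; here the value is \<open>\<infinity>\<close>.\<close>

definition dist_zero :: "'a::real_normed_vector set \<Rightarrow> ereal" where
  "dist_zero S = (INF s\<in>S. ereal (norm s))"

definition obj :: "('n::finite symmat \<Rightarrow> real) \<Rightarrow> (real ^ 'p) set \<Rightarrow> 'n symmat \<times> (real ^ 'p) \<Rightarrow> ereal"
  where "obj f P = (\<lambda>(X, y). ereal (f X) + convex_indicator psd_cone X + convex_indicator P y)"

definition constr ::
  "('n::finite symmat \<Rightarrow> real ^ 'm) \<Rightarrow> ('n symmat \<Rightarrow> real ^ 'p) \<Rightarrow>
    'n symmat \<times> (real ^ 'p) \<Rightarrow> (real ^ 'm) \<times> (real ^ 'p)"
  where "constr \<A> \<B> = (\<lambda>(X, y). (\<A> X, \<B> X - y))"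

definition rhs :: "real ^ 'm \<Rightarrow> (real ^ 'm) \<times> (real ^ 'p)" where
  "rhs b = (b, 0)"

text \<open>
  Indices start at 1. The step producing \<open>R (k + 1)\<close> is left unconstrained here: the accuracy
  to which the subproblem is solved is a separate condition, \<open>subproblem_residual\<close> below.
\<close>

definition palm_sequence ::
  "('n::finite symmat \<Rightarrow> real ^ 'm) \<Rightarrow> ('n symmat \<Rightarrow> real ^ 'p) \<Rightarrow> real ^ 'm \<Rightarrow> (real ^ 'p) set \<Rightarrow>
    real \<Rightarrow> real \<Rightarrow> (nat \<Rightarrow> 'm symmat) \<Rightarrow> (nat \<Rightarrow> real ^ 'r ^ 'n) \<Rightarrow>
    (nat \<Rightarrow> 'n symmat) \<Rightarrow> (nat \<Rightarrow> real ^ 'p) \<Rightarrow> (nat \<Rightarrow> real ^ 'm) \<Rightarrow> (nat \<Rightarrow> real ^ 'p) \<Rightarrow> bool"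
  where
  "palm_sequence \<A> \<B> b P \<beta>1 \<beta>2 W R X y lam mu \<longleftrightarrow>
    (\<forall>k\<ge>1. posdef (W k)) \<and>
    (\<forall>k\<ge>1. X k = gram (R k)) \<and>
    (\<forall>k\<ge>1. y (Suc k) = closest_point P (\<B> (X (Suc k)) - mu k /\<^sub>R \<beta>2)) \<and>
    (\<forall>k\<ge>1. lam (Suc k) = lam k - \<beta>1 *\<^sub>R (mat_of (W k) *v (\<A> (X (Suc k)) - b))) \<and>
    (\<forall>k\<ge>1. mu (Suc k) =
      \<beta>2 *\<^sub>R (closest_point P (\<B> (X (Suc k)) - mu k /\<^sub>R \<beta>2) - (\<B> (X (Suc k)) - mu k /\<^sub>R \<beta>2)))"

text \<open>Here \<open>W\<close>, \<open>l\<close>, \<open>u\<close> are taken at step \<open>k\<close>, and \<open>X\<close> at step \<open>k + 1\<close>.\<close>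

definition subproblem_residual ::
  "('n::finite symmat \<Rightarrow> 'n symmat) \<Rightarrow>
    ('n symmat \<Rightarrow> real ^ 'm) \<Rightarrow> ('n symmat \<Rightarrow> real ^ 'p) \<Rightarrow> real ^ 'm \<Rightarrow> (real ^ 'p) set \<Rightarrow>
    real \<Rightarrow> real \<Rightarrow> 'm symmat \<Rightarrow> real ^ 'm \<Rightarrow> real ^ 'p \<Rightarrow> 'n symmat \<Rightarrow> ereal"
  where
  "subproblem_residual gradf \<A> \<B> b P \<beta>1 \<beta>2 W l u X =
    dist_zero ((\<lambda>V. V + gradf X - adjoint \<A> l
        + \<beta>1 *\<^sub>R adjoint \<A> (mat_of W *v (\<A> X - b))
        + \<beta>2 *\<^sub>R adjoint \<B> (\<B> X - u /\<^sub>R \<beta>2 - closest_point P (\<B> X - u /\<^sub>R \<beta>2)))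
      ` subdifferential (convex_indicator psd_cone) X)"

definition kkt_residual ::
  "('n::finite symmat \<Rightarrow> real) \<Rightarrow>
    ('n symmat \<Rightarrow> real ^ 'm) \<Rightarrow> ('n symmat \<Rightarrow> real ^ 'p) \<Rightarrow> real ^ 'm \<Rightarrow> (real ^ 'p) set \<Rightarrow>
    'n symmat \<times> (real ^ 'p) \<Rightarrow> (real ^ 'm) \<times> (real ^ 'p) \<Rightarrow> ereal"
  where
  "kkt_residual f \<A> \<B> b P z \<gamma> =
    max (dist_zero ((\<lambda>v. v - adjoint (constr \<A> \<B>) \<gamma>) ` subdifferential (obj f P) z))
        (ereal (norm (constr \<A> \<B> z - rhs b)))"

end

theory Submission
  imports Defs
begin

text \<open>
  The method is an inexact proximal point method on the dual problem. Write
  \<open>L(z, \<gamma>) = g(z) - \<langle>\<gamma>, \<H>(z) - c\<rangle>\<close> for the Lagrangian. Substituting the multiplier updates into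
  the stationarity condition of the subproblem turns it into \<open>v - \<H>\<^sup>*(\<gamma>\<^sup>k) = (E, 0)\<close> with
  \<open>v \<in> \<partial>g(z\<^sup>k)\<close> and \<open>\<parallel>E\<parallel> < \<epsilon>\<close> (lemma \<open>palm_step_dual_residual\<close>). This is the dual half
  of the residual. It also says that \<open>z\<^sup>k\<close> minimises \<open>L(\<cdot>, \<gamma>\<^sup>k)\<close> up to an error
  proportional to \<open>\<epsilon>\<close>.

  For the primal half, put \<open>l\<^sub>k = L(z\<^sup>k, \<gamma>\<^sup>k)\<close>, an inexact dual value at \<open>\<gamma>\<^sup>k\<close>, and let
  \<open>h\<^sup>k = \<H>(z\<^sup>k) - c\<close>. Comparing \<open>z\<^sup>k\<close> with \<open>z\<^bsup>k+1\<^esup>\<close> in \<open>L(\<cdot>, \<gamma>\<^sup>k)\<close> gives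
  \<open>l\<^bsub>k+1\<^esub> \<ge> l\<^sub>k + \<langle>\<gamma>\<^sup>k - \<gamma>\<^bsup>k+1\<^esup>, h\<^bsup>k+1\<^esup>\<rangle> - error\<close>,
  and the inner product is at least a positive multiple of \<open>\<parallel>h\<^bsup>k+1\<^esup>\<parallel>\<^sup>2\<close>, since the step
  matrices are uniformly positive definite. Comparing \<open>z\<^sup>k\<close> with a feasible point \<open>z\<^sup>*\<close> gives
  \<open>l\<^sub>k \<le> g(z\<^sup>*) + error\<close> (weak duality). As \<open>z\<^sup>k\<close> is bounded the errors are summable, so the
  ascents are summable too and \<open>h\<^sup>k\<close> tends to \<open>0\<close> (lemma \<open>dual_ascent_feasibility\<close>).
  The argument follows dual values instead of distances between multipliers, which
  would have to be measured in the norm of \<open>W\<^sup>k\<close> and so would not telescope as \<open>W\<^sup>k\<close> varies.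
\<close>

section \<open>Inexact dual ascent\<close>

lemma summable_of_bounded_ascent:
  fixes l a e :: "nat \<Rightarrow> real"
  assumes ascent: "\<And>k. l k + a k - e k \<le> l (Suc k)"
    and bound: "\<And>k. l k \<le> C"
    and a: "\<And>k. 0 \<le> a k" and e: "\<And>k. 0 \<le> e k" "summable e"
  shows "summable a"
proof (rule summableI_nonneg_bounded[OF a])
  fix n
  have "(\<Sum>k<n. a k) \<le> l n - l 0 + (\<Sum>k<n. e k)"
  proof (induction n)
    case (Suc n)
    then show ?case
      using ascent[of n] by simp
  qed simp
  also have "\<dots> \<le> C - l 0 + suminf e"
    using bound[of n] sum_le_suminf[OF e(2), of "{..<n}"] e(1) by force
  finally show "(\<Sum>k<n. a k) \<le> C - l 0 + suminf e" .
qed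

text \<open>
  The abstract form of the dual ascent argument. The points \<open>z k\<close> minimise the Lagrangian at
  \<open>\<gamma> k\<close> over \<open>D\<close> up to an error relative to the distance, and \<open>\<gamma>\<close> moves by at least a fixed
  multiple of the next constraint violation, measured along that violation.
\<close>

lemma dual_ascent_feasibility:
  fixes g :: "'a::real_normed_vector \<Rightarrow> real" and H :: "'a \<Rightarrow> 'b::real_inner"
  assumes approx_min: "\<And>k w. w \<in> D \<Longrightarrow>
      g (z k) - inner (\<gamma> k) (H (z k) - c) \<le> g w - inner (\<gamma> k) (H w - c) + e k * norm (w - z k)"
    and step: "\<And>k. \<sigma> * (norm (H (z (Suc k)) - c))\<^sup>2
      \<le> inner (\<gamma> k - \<gamma> (Suc k)) (H (z (Suc k)) - c)"
    and "\<sigma> > 0" and z: "\<And>k. z k \<in> D" and bdd: "bounded (range z)"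
    and e: "\<And>k. 0 \<le> e k" "summable e"
    and feasible: "w \<in> D" "H w = c"
  shows "(\<lambda>k. H (z k) - c) \<longlonglongrightarrow> 0"
proof -
  define l where "l k = g (z k) - inner (\<gamma> k) (H (z k) - c)" for k
  obtain M where M: "M > 0" "\<And>x. x \<in> insert w (range z) \<Longrightarrow> norm x \<le> M"
    using bdd bounded_insert[of w "range z"] by (auto simp: bounded_pos)
  have dist: "norm (x - z k) \<le> 2 * M" if "x \<in> insert w (range z)" for x k
    using norm_triangle_ineq4[of x "z k"] M(2)[OF that] M(2)[of "z k"] by simp
  have err: "e k * norm (x - z k) \<le> e k * (2 * M)" if "x \<in> insert w (range z)" for x k
    using dist[OF that] e(1) by (rule mult_left_mono)
  have "summable (\<lambda>k. \<sigma> * (norm (H (z (Suc k)) - c))\<^sup>2)"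
  proof (rule summable_of_bounded_ascent)
    fix k
    have "l k \<le> g (z (Suc k)) - inner (\<gamma> k) (H (z (Suc k)) - c) + e k * (2 * M)"
      using approx_min[OF z, of k "Suc k"] err[of "z (Suc k)" k] by (simp add: l_def)
    then show "l k + \<sigma> * (norm (H (z (Suc k)) - c))\<^sup>2 - e k * (2 * M) \<le> l (Suc k)"
      using step[of k] by (simp add: l_def inner_diff_left)
  next
    fix k
    have "e k \<le> suminf e"
      using sum_le_suminf[OF e(2), of "{k}"] e(1) by simp
    then have "e k * (2 * M) \<le> suminf e * (2 * M)"
      using M(1) by (intro mult_right_mono) auto
    then show "l k \<le> g w + suminf e * (2 * M)"
      using approx_min[OF feasible(1), of k] err[of w k] feasible(2) by (simp add: l_def)
  qed (use \<open>\<sigma> > 0\<close> M(1) e in \<open>auto intro: summable_mult2\<close>)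
  then have "(\<lambda>k. \<sigma> * (norm (H (z (Suc k)) - c))\<^sup>2) \<longlonglongrightarrow> 0"
    by (rule summable_LIMSEQ_zero)
  from tendsto_mult_left[OF this, of "inverse \<sigma>"]
  have "(\<lambda>k. (norm (H (z (Suc k)) - c))\<^sup>2) \<longlonglongrightarrow> 0"
    using \<open>\<sigma> > 0\<close> by (simp add: mult.assoc[symmetric])
  from tendsto_real_sqrt[OF this]
  have "(\<lambda>k. norm (H (z (Suc k)) - c)) \<longlonglongrightarrow> 0"
    by simp
  then have "(\<lambda>k. H (z (Suc k)) - c) \<longlonglongrightarrow> 0"
    by (rule tendsto_norm_zero_cancel)
  then show ?thesis
    by (rule LIMSEQ_imp_Suc)
qed

section \<open>Subdifferentials\<close>

lemma convex_on_gradient_inequality: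
  fixes f :: "'a::real_inner \<Rightarrow> real"
  assumes f: "convex_on UNIV f" and D: "GDERIV f x :> D"
  shows "f x + inner D (y - x) \<le> f y"
proof -
  define \<phi> where "\<phi> t = f (x + t *\<^sub>R (y - x))" for t :: real
  have "convex_on UNIV \<phi>"
  proof (rule convex_onI)
    fix t s r :: real
    assume t: "0 < t" "t < 1"
    have "x + ((1 - t) *\<^sub>R s + t *\<^sub>R r) *\<^sub>R (y - x)
        = (1 - t) *\<^sub>R (x + s *\<^sub>R (y - x)) + t *\<^sub>R (x + r *\<^sub>R (y - x))"
      by (simp add: algebra_simps)
    then show "\<phi> ((1 - t) *\<^sub>R s + t *\<^sub>R r) \<le> (1 - t) * \<phi> s + t * \<phi> r"
      using convex_onD[OF f, of t] t by (simp add: \<phi>_def)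
  qed simp
  moreover have "(\<phi> has_field_derivative inner D (y - x)) (at 0)"
  proof -
    have "(f has_derivative (\<lambda>h. inner h D)) (at (x + 0 *\<^sub>R (y - x)))"
      using D by (simp add: gderiv_def)
    moreover have "((\<lambda>t. x + t *\<^sub>R (y - x)) has_derivative (\<lambda>t. t *\<^sub>R (y - x))) (at (0::real))"
      by (auto intro!: derivative_eq_intros)
    ultimately have "(\<phi> has_derivative (\<lambda>t. inner (t *\<^sub>R (y - x)) D)) (at 0)"
      unfolding \<phi>_def by (rule has_derivative_compose[rotated])
    then show ?thesis
      by (simp add: has_field_derivative_def inner_commute mult.commute[of _ "inner D _"])
  qed
  ultimately have "inner D (y - x) * (1 - 0) \<le> \<phi> 1 - \<phi> 0"
    by (intro convex_on_imp_above_tangent[where A = UNIV]) auto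
  then show ?thesis
    by (simp add: \<phi>_def)
qed

lemma subdifferential_convex_indicator:
  assumes "C \<noteq> {}"
  shows "v \<in> subdifferential (convex_indicator C) x
    \<longleftrightarrow> x \<in> C \<and> (\<forall>y\<in>C. inner v (y - x) \<le> 0)"
  using assms by (auto simp: subdifferential_def convex_indicator_def)

lemma zero_mem_psd_cone: "0 \<in> psd_cone"
  by (simp add: psd_cone_def psd_def zero_symmat.rep_eq)

lemma obj_in_domain:
  "X \<in> psd_cone \<Longrightarrow> y \<in> P \<Longrightarrow> obj f P (X, y) = ereal (f X)"
  by (simp add: obj_def convex_indicator_def)

lemma subdifferential_obj_I:
  assumes f: "convex_on UNIV f" "GDERIV f X :> G"
    and V: "V \<in> subdifferential (convex_indicator psd_cone) X"
    and u: "u \<in> subdifferential (convex_indicator P) y" and y: "y \<in> P"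
  shows "(V + G, u) \<in> subdifferential (obj f P) (X, y)"
  unfolding subdifferential_def
proof (intro CollectI allI)
  fix w :: "'a symmat \<times> (real ^ 'b)"
  obtain X' y' where w: "w = (X', y')" by fastforce
  have X: "X \<in> psd_cone" and V': "\<And>Y. Y \<in> psd_cone \<Longrightarrow> inner V (Y - X) \<le> 0"
    using V zero_mem_psd_cone by (subst (asm) subdifferential_convex_indicator; blast)+
  have u': "\<And>x. x \<in> P \<Longrightarrow> inner u (x - y) \<le> 0"
    using u y by (subst (asm) subdifferential_convex_indicator; blast)
  show "obj f P (X, y) + ereal (inner (V + G, u) (w - (X, y))) \<le> obj f P w"
  proof (cases "X' \<in> psd_cone \<and> y' \<in> P")
    case True
    then show ?thesis
      using V'[of X'] u'[of y'] convex_on_gradient_inequality[OF f, of X'] X y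
      by (simp add: w obj_in_domain inner_add_left)
  next
    case False
    then have "obj f P w = \<infinity>"
      by (auto simp: w obj_def convex_indicator_def)
    then show ?thesis by simp
  qed
qed

lemma subdifferential_obj_D:
  assumes "v \<in> subdifferential (obj f P) (X, y)" "X \<in> psd_cone" "y \<in> P" "w \<in> psd_cone \<times> P"
  shows "f X + inner v (w - (X, y)) \<le> f (fst w)"
proof -
  have "obj f P (X, y) + ereal (inner v (w - (X, y))) \<le> obj f P w"
    using assms(1) unfolding subdifferential_def by blast
  then show ?thesis
    using assms(2-4) by (cases w) (simp add: obj_in_domain)
qed

lemma closest_point_subdifferential:
  fixes P :: "'a::euclidean_space set"
  assumes "closed P" "convex P" "P \<noteq> {}"
  shows "x - closest_point P x \<in> subdifferential (convex_indicator P) (closest_point P x)"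
  using assms by (simp add: subdifferential_convex_indicator closest_point_in_set closest_point_dot)

lemma subdifferential_convex_indicator_scaleR:
  assumes "v \<in> subdifferential (convex_indicator C) x" "C \<noteq> {}" "0 \<le> t"
  shows "t *\<^sub>R v \<in> subdifferential (convex_indicator C) x"
  using assms by (auto simp: subdifferential_convex_indicator mult_nonneg_nonpos)

section \<open>The constraint map and the weight matrices\<close>

lemma linear_constr:
  assumes "linear \<A>" "linear \<B>"
  shows "linear (constr \<A> \<B>)"
  using assms by (auto simp: linear_iff constr_def algebra_simps split: prod.splits)

lemma adjoint_constr:
  fixes \<A> :: "'n::finite symmat \<Rightarrow> real ^ 'm" and \<B> :: "'n symmat \<Rightarrow> real ^ 'p"
  assumes "linear \<A>" "linear \<B>"
  shows "adjoint (constr \<A> \<B>) (l, u) = (adjoint \<A> l + adjoint \<B> u, - u)"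
proof -
  have "adjoint (constr \<A> \<B>) = (\<lambda>(l, u). (adjoint \<A> l + adjoint \<B> u, - u))"
    by (rule adjoint_unique)
      (use assms in \<open>auto simp: constr_def adjoint_works inner_add_right inner_diff_left\<close>)
  then show ?thesis by simp
qed

lemma psd_diff_id_iff:
  "psd (A - \<sigma> *\<^sub>R id_symmat) \<longleftrightarrow> (\<forall>u. \<sigma> * (norm u)\<^sup>2 \<le> inner u (mat_of A *v u))"
  by (simp add: psd_def minus_symmat.rep_eq scaleR_symmat.rep_eq id_symmat.rep_eq
      matrix_vector_mult_diff_rdistrib scaleR_matrix_vector_assoc[symmetric] inner_diff_right
      power2_norm_eq_inner)

section \<open>One step of the method\<close>

text \<open>
  The multiplier updates are made so that the gradient of the augmented Lagrangian at the old
  multipliers is the gradient of the ordinary Lagrangian at the new ones. In the \<open>y\<close> component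
  the residual vanishes, because \<open>-\<mu>\<close> after the update is a positive multiple of the projection
  error and so lies in the normal cone of \<open>P\<close>.
\<close>

lemma palm_step_dual_residual:
  assumes f: "convex_on UNIV f" "GDERIV f X :> gradf X"
    and lin: "linear \<A>" "linear \<B>"
    and P: "closed P" "convex P" "P \<noteq> {}" and "\<beta>2 > 0"
    and y: "y = closest_point P (\<B> X - u /\<^sub>R \<beta>2)"
    and l': "l' = l - \<beta>1 *\<^sub>R (mat_of W *v (\<A> X - b))"
    and u': "u' = \<beta>2 *\<^sub>R (y - (\<B> X - u /\<^sub>R \<beta>2))"
    and res: "subproblem_residual gradf \<A> \<B> b P \<beta>1 \<beta>2 W l u X < ereal \<epsilon>"
  obtains v where "v \<in> subdifferential (obj f P) (X, y)"
    and "norm (v - adjoint (constr \<A> \<B>) (l', u')) < \<epsilon>" and "X \<in> psd_cone" and "y \<in> P"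
proof -
  obtain V where V: "V \<in> subdifferential (convex_indicator psd_cone) X"
    and norm: "norm (V + gradf X - adjoint \<A> l
        + \<beta>1 *\<^sub>R adjoint \<A> (mat_of W *v (\<A> X - b))
        + \<beta>2 *\<^sub>R adjoint \<B> (\<B> X - u /\<^sub>R \<beta>2 - y)) < \<epsilon>"
    using res by (auto simp: subproblem_residual_def dist_zero_def INF_less_iff y)
  have "- u' = \<beta>2 *\<^sub>R (\<B> X - u /\<^sub>R \<beta>2 - y)"
    by (simp add: u' algebra_simps)
  then have u: "- u' \<in> subdifferential (convex_indicator P) y"
    using closest_point_subdifferential[OF P] P(3) \<open>\<beta>2 > 0\<close>
    by (simp add: y subdifferential_convex_indicator_scaleR)
  have yP: "y \<in> P"
    using P by (simp add: y closest_point_in_set)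
  have X: "X \<in> psd_cone"
    using V zero_mem_psd_cone by (subst (asm) subdifferential_convex_indicator; blast)
  have linA: "linear (adjoint \<A>)" and linB: "linear (adjoint \<B>)"
    using lin by (simp_all add: adjoint_linear)
  have "adjoint \<A> l' = adjoint \<A> l - \<beta>1 *\<^sub>R adjoint \<A> (mat_of W *v (\<A> X - b))"
    by (simp add: l' linear_diff[OF linA] linear_cmul[OF linA])
  moreover have "adjoint \<B> u' = - (\<beta>2 *\<^sub>R adjoint \<B> (\<B> X - u /\<^sub>R \<beta>2 - y))"
    unfolding linear_cmul[OF linB, symmetric] linear_neg[OF linB, symmetric]
    by (simp add: u' algebra_simps)
  ultimately have "(V + gradf X, - u') - adjoint (constr \<A> \<B>) (l', u')
      = (V + gradf X - adjoint \<A> l + \<beta>1 *\<^sub>R adjoint \<A> (mat_of W *v (\<A> X - b))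
        + \<beta>2 *\<^sub>R adjoint \<B> (\<B> X - u /\<^sub>R \<beta>2 - y), 0)"
    by (simp add: adjoint_constr[OF lin])
  then have "norm ((V + gradf X, - u') - adjoint (constr \<A> \<B>) (l', u')) < \<epsilon>"
    using norm by (simp add: norm_Pair)
  with subdifferential_obj_I[OF f V u yP] show ?thesis
    using X yP by (rule that)
qed

text \<open>
  Adding the affine term of the Lagrangian to \<open>g\<close> shifts its subdifferential by \<open>-\<H>\<^sup>*(\<gamma>)\<close>, so
  a small element there is an approximate minimality certificate by Cauchy--Schwarz.
\<close>

lemma lagrangian_approx_min:
  assumes H: "linear (constr \<A> \<B>)"
    and v: "v \<in> subdifferential (obj f P) (X, y)"
    and small: "norm (v - adjoint (constr \<A> \<B>) \<gamma>) < \<epsilon>"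
    and dom: "X \<in> psd_cone" "y \<in> P" "w \<in> psd_cone \<times> P"
  shows "f X - inner \<gamma> (constr \<A> \<B> (X, y) - c)
    \<le> f (fst w) - inner \<gamma> (constr \<A> \<B> w - c) + \<epsilon> * norm (w - (X, y))"
proof -
  define d where "d = w - (X, y)"
  define E where "E = v - adjoint (constr \<A> \<B>) \<gamma>"
  have "inner (- E) d \<le> norm E * norm d"
    using norm_cauchy_schwarz[of "- E" d] by simp
  also have "\<dots> \<le> \<epsilon> * norm d"
    using small by (intro mult_right_mono) (auto simp: E_def)
  finally have "- inner E d \<le> \<epsilon> * norm d" by simp
  moreover have "inner (adjoint (constr \<A> \<B>) \<gamma>) d
      = inner \<gamma> (constr \<A> \<B> w) - inner \<gamma> (constr \<A> \<B> (X, y))"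
    using adjoint_works[OF H, of d \<gamma>]
    by (simp add: d_def linear_diff[OF H] inner_commute inner_diff_right)
  moreover have "f X + inner v d \<le> f (fst w)"
    unfolding d_def using v dom by (rule subdifferential_obj_D)
  ultimately show ?thesis
    unfolding d_def[symmetric] by (simp add: E_def inner_diff_left inner_diff_right)
qed

section \<open>Convergence of the KKT residual\<close>

theorem theorem1:
  fixes f :: "'n::finite symmat \<Rightarrow> real"
    and gradf :: "'n symmat \<Rightarrow> 'n symmat"
    and \<A> :: "'n symmat \<Rightarrow> real ^ 'm::finite"
    and \<B> :: "'n symmat \<Rightarrow> real ^ 'p::finite"
    and b :: "real ^ 'm"
    and P :: "(real ^ 'p) set"
    and \<beta>1 \<beta>2 :: real
    and W :: "nat \<Rightarrow> 'm symmat"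
    and R :: "nat \<Rightarrow> real ^ 'r::finite ^ 'n"
    and X :: "nat \<Rightarrow> 'n symmat"
    and y :: "nat \<Rightarrow> real ^ 'p"
    and lam :: "nat \<Rightarrow> real ^ 'm"
    and mu :: "nat \<Rightarrow> real ^ 'p"
    and eps :: "nat \<Rightarrow> real"
  assumes "convex_on UNIV f"
    and "\<And>Z. GDERIV f Z :> gradf Z"
    and "continuous_on UNIV gradf"
    and "linear \<A>"
    and "linear \<B>"
    and "closed P"
    and "convex P"
    and "\<beta>1 > 0"
    and "\<beta>2 > 0"
    and "palm_sequence \<A> \<B> b P \<beta>1 \<beta>2 W R X y lam mu"
    and feasible: "\<exists>z \<in> psd_cone \<times> P. constr \<A> \<B> z = rhs b"
    and "\<And>k. k \<ge> 1 \<Longrightarrow> eps k > 0"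
    and "summable (\<lambda>k. eps (Suc k))"
    and inexact: "\<And>k. k \<ge> 1 \<Longrightarrow>
      subproblem_residual gradf \<A> \<B> b P \<beta>1 \<beta>2 (W k) (lam k) (mu k) (X (Suc k)) < ereal (eps k)"
    and bounded: "bounded ((\<lambda>k. (X k, y k)) ` {1..})"
    and "\<exists>\<sigma>>0. \<forall>k\<ge>1. psd (W k - \<sigma> *\<^sub>R id_symmat)"
  shows "(\<lambda>k. kkt_residual f \<A> \<B> b P (X k, y k) (lam k, mu k)) \<longlonglongrightarrow> 0"
proof -
  note f = assms(1) and df = assms(2) and lin = assms(4,5) and P = assms(6,7)
    and \<beta> = assms(8,9) and seq = assms(10)[unfolded palm_sequence_def]
  obtain \<sigma> where \<sigma>: "\<sigma> > 0"
    "\<And>k u. k \<ge> 1 \<Longrightarrow> \<sigma> * (norm u)\<^sup>2 \<le> inner u (mat_of (W k) *v u)"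
    using assms(16) by (auto simp: psd_diff_id_iff)
  obtain zs where zs: "zs \<in> psd_cone \<times> P" "constr \<A> \<B> zs = rhs b"
    using feasible by blast
  have "P \<noteq> {}"
    using zs(1) by auto
  let ?H = "constr \<A> \<B>"
  \<comment> \<open>Only the iterates from index 2 on are produced by a step; \<open>X 1\<close> and \<open>y 1\<close> carry no residual bound,
    and \<open>y 1\<close> need not lie in \<open>P\<close>.\<close>
  define z where "z k = (X (k + 2), y (k + 2))" for k
  define \<gamma> where "\<gamma> k = (lam (k + 2), mu (k + 2))" for k
  define e where "e k = eps (Suc k)" for k
  have mu: "mu (Suc k) = \<beta>2 *\<^sub>R (y (Suc k) - (\<B> (X (Suc k)) - mu k /\<^sub>R \<beta>2))" if "k \<ge> 1" for k
    using seq that by simp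
  have lam: "lam (Suc k) = lam k - \<beta>1 *\<^sub>R (mat_of (W k) *v (\<A> (X (Suc k)) - b))" if "k \<ge> 1" for k
    using seq that by blast
  have "\<exists>v. v \<in> subdifferential (obj f P) (z k) \<and> norm (v - adjoint ?H (\<gamma> k)) < e k
      \<and> fst (z k) \<in> psd_cone \<and> snd (z k) \<in> P" for k
    by (rule palm_step_dual_residual[OF f df lin P \<open>P \<noteq> {}\<close> \<beta>(2) _ _ _ inexact[of "Suc k"]])
      (use seq mu[of "Suc k"] in \<open>auto simp: z_def \<gamma>_def e_def\<close>)
  then obtain v where v: "\<And>k. v k \<in> subdifferential (obj f P) (z k)"
    "\<And>k. norm (v k - adjoint ?H (\<gamma> k)) < e k"
    and dom: "\<And>k. fst (z k) \<in> psd_cone" "\<And>k. snd (z k) \<in> P"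
    by metis
  have e: "e k > 0" for k
    using assms(12) by (simp add: e_def)
  have "summable e"
    unfolding e_def by (rule assms(13))
  have "(\<lambda>k. ?H (z k) - rhs b) \<longlonglongrightarrow> 0"
  proof (rule dual_ascent_feasibility[where g = "f \<circ> fst" and D = "psd_cone \<times> P"
        and \<sigma> = "min (\<beta>1 * \<sigma>) \<beta>2" and w = zs])
    fix k :: nat and w :: "'n symmat \<times> (real ^ 'p)"
    assume "w \<in> psd_cone \<times> P"
    then show "(f \<circ> fst) (z k) - inner (\<gamma> k) (?H (z k) - rhs b)
        \<le> (f \<circ> fst) w - inner (\<gamma> k) (?H w - rhs b) + e k * norm (w - z k)"
      using lagrangian_approx_min[OF linear_constr[OF lin], of "v k" f P "fst (z k)" "snd (z k)"] v dom
      by simp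
  next
    fix k
    let ?h = "\<A> (X (k + 3)) - b" and ?r = "\<B> (X (k + 3)) - y (k + 3)"
    have "lam (k + 3) = lam (k + 2) - \<beta>1 *\<^sub>R (mat_of (W (k + 2)) *v ?h)"
      using lam[of "k + 2"] by (simp add: numeral_3_eq_3)
    moreover have "mu (k + 3) = mu (k + 2) - \<beta>2 *\<^sub>R ?r"
      using mu[of "k + 2"] \<beta>(2) by (simp add: numeral_3_eq_3 scaleR_diff_right)
    ultimately have "\<gamma> k - \<gamma> (Suc k) = (\<beta>1 *\<^sub>R (mat_of (W (k + 2)) *v ?h), \<beta>2 *\<^sub>R ?r)"
      by (simp add: \<gamma>_def numeral_3_eq_3)
    moreover have h: "?H (z (Suc k)) - rhs b = (?h, ?r)"
      by (simp add: z_def constr_def rhs_def numeral_3_eq_3)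
    ultimately have "inner (\<gamma> k - \<gamma> (Suc k)) (?H (z (Suc k)) - rhs b)
        = \<beta>1 * inner ?h (mat_of (W (k + 2)) *v ?h) + \<beta>2 * (norm ?r)\<^sup>2"
      by (simp add: inner_commute power2_norm_eq_inner)
    also have "\<dots> \<ge> \<beta>1 * (\<sigma> * (norm ?h)\<^sup>2) + \<beta>2 * (norm ?r)\<^sup>2"
      using \<sigma>(2)[of "k + 2" ?h] \<beta>(1) by simp
    also have "\<beta>1 * (\<sigma> * (norm ?h)\<^sup>2) + \<beta>2 * (norm ?r)\<^sup>2
        \<ge> min (\<beta>1 * \<sigma>) \<beta>2 * (norm ?h)\<^sup>2 + min (\<beta>1 * \<sigma>) \<beta>2 * (norm ?r)\<^sup>2"
      unfolding mult.assoc[symmetric] by (intro add_mono mult_right_mono) auto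
    finally show "min (\<beta>1 * \<sigma>) \<beta>2 * (norm (?H (z (Suc k)) - rhs b))\<^sup>2
        \<le> inner (\<gamma> k - \<gamma> (Suc k)) (?H (z (Suc k)) - rhs b)"
      by (simp add: h norm_Pair distrib_left)
  next
    show "bounded (range z)"
      by (rule bounded_subset[OF bounded]) (auto simp: z_def)
  next
    show "z k \<in> psd_cone \<times> P" for k
      using dom[of k] by (simp add: mem_Times_iff)
  qed (use \<beta> \<sigma>(1) e \<open>summable e\<close> zs in \<open>auto intro: less_imp_le\<close>)
  then have "(\<lambda>k. norm (?H (z k) - rhs b)) \<longlonglongrightarrow> 0"
    by (rule tendsto_norm_zero)
  from tendsto_max[OF summable_LIMSEQ_zero[OF \<open>summable e\<close>] this]
  have upper: "(\<lambda>k. ereal (max (e k) (norm (?H (z k) - rhs b)))) \<longlonglongrightarrow> 0"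
    unfolding zero_ereal_def by (intro tendsto_ereal) simp
  have "(\<lambda>k. kkt_residual f \<A> \<B> b P (z k) (\<gamma> k)) \<longlonglongrightarrow> 0"
  proof (rule tendsto_sandwich[OF _ _ tendsto_const upper]; intro always_eventually allI)
    fix k
    show "0 \<le> kkt_residual f \<A> \<B> b P (z k) (\<gamma> k)"
      by (simp add: kkt_residual_def le_max_iff_disj)
    have "dist_zero ((\<lambda>v. v - adjoint ?H (\<gamma> k)) ` subdifferential (obj f P) (z k))
        \<le> ereal (norm (v k - adjoint ?H (\<gamma> k)))"
      unfolding dist_zero_def using v(1)[of k] by (intro INF_lower imageI)
    also have "\<dots> \<le> ereal (e k)"
      using v(2)[of k] by simp
    finally show "kkt_residual f \<A> \<B> b P (z k) (\<gamma> k)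
        \<le> ereal (max (e k) (norm (?H (z k) - rhs b)))"
      by (auto simp: kkt_residual_def intro: order_trans)
  qed
  then show ?thesis
    unfolding z_def \<gamma>_def by (rule LIMSEQ_offset)
qed

end
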